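(* Let $p(n)$ denote the number of maximal independent sets of the (ortho) pentagonal cactus $P(n)$. Then $p(1)=5$, $p(2)=13$, $p(3)=42$, $p(4)=127$, and $p(n)=p(n-1)+5p(n-2)+4p(n-3)$ for all $n\ge 5$.
   Context: For $n\ge 1$, the (ortho) pentagonal cactus $P(n)$ is the graph formed by a chain of $n$ 5-cycles $B_1,\dots,B_n$, where for each $1\le i\le n-1$ the consecutive cycles $B_i$ and $B_{i+1}$ share exactly one vertex, non-consecutive cycles share no vertex, every vertex lies in at most two cycles, and for each $2\le i\le n-1$ the two shared (cut) vertices of $B_i$ are adjacent. An independent set is maximal if no further vertex can be added while keeping it independent. *)

theory Defs
  imports "HOL-Library.Ramsey"
begin

text \<open>A simple graph is given by its vertex set \<open>V\<close> and its set \<open>E\<close> of edges, which are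
  two-element sets of vertices. Independence is \<^const>\<open>indep\<close> from the library.\<close>

definition maximal_independent_set :: "'a set \<Rightarrow> 'a set set \<Rightarrow> 'a set \<Rightarrow> bool" where
  "maximal_independent_set V E S \<longleftrightarrow>
     S \<subseteq> V \<and> indep S E \<and> (\<forall>v\<in>V - S. \<not> indep (insert v S) E)"

definition five_cycle :: "'a set \<Rightarrow> 'a set set \<Rightarrow> bool" where
  "five_cycle C F \<longleftrightarrow>
     (\<exists>a b c d e. distinct [a, b, c, d, e] \<and> C = {a, b, c, d, e} \<and>
        F = {{a, b}, {b, c}, {c, d}, {d, e}, {e, a}})"

text \<open>\<open>B i\<close> and \<open>F i\<close> are the vertex set and the edge set of the \<open>i\<close>-th cycle. The last
  clause says that the two cut vertices of an inner cycle are adjacent.\<close>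

definition ortho_pentagonal_cactus :: "nat \<Rightarrow> 'a set \<Rightarrow> 'a set set \<Rightarrow> bool" where
  "ortho_pentagonal_cactus n V E \<longleftrightarrow>
     (\<exists>B F. (\<forall>i\<in>{1..n}. five_cycle (B i) (F i)) \<and>
        V = (\<Union>i\<in>{1..n}. B i) \<and> E = (\<Union>i\<in>{1..n}. F i) \<and>
        (\<forall>i\<in>{1..<n}. card (B i \<inter> B (i + 1)) = 1) \<and>
        (\<forall>i\<in>{1..n}. \<forall>j\<in>{1..n}. i + 1 < j \<longrightarrow> B i \<inter> B j = {}) \<and>
        (\<forall>v\<in>V. card {i\<in>{1..n}. v \<in> B i} \<le> 2) \<and>
        (\<forall>i\<in>{2..<n}. \<forall>u\<in>B (i - 1) \<inter> B i. \<forall>w\<in>B i \<inter> B (i + 1). {u, w} \<in> E))"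

text \<open>Such graphs exist for every \<open>n\<close>: take the path \<open>0, 1, \<dots>, 4n\<close> with the additional
  edges joining \<open>4i\<close> and \<open>4i + 4\<close>.\<close>

lemma ortho_pentagonal_cactus_exists:
  "\<exists>(V :: nat set) E. ortho_pentagonal_cactus n V E"
proof -
  define B :: "nat \<Rightarrow> nat set" where "B i = {4*i-4, 4*i-3, 4*i-2, 4*i-1, 4*i}" for i
  define F :: "nat \<Rightarrow> nat set set" where
    "F i = {{4*i-4, 4*i-3}, {4*i-3, 4*i-2}, {4*i-2, 4*i-1}, {4*i-1, 4*i}, {4*i, 4*i-4}}" for i
  have mem: "v \<in> B i \<longleftrightarrow> 4*i \<le> v + 4 \<and> v \<le> 4*i" if "i \<ge> 1" for i v
    using that by (auto simp: B_def)
  have cyc: "five_cycle (B i) (F i)" if "i \<ge> 1" for i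
    unfolding five_cycle_def B_def F_def
    by (rule exI[of _ "4*i-4"], rule exI[of _ "4*i-3"], rule exI[of _ "4*i-2"],
        rule exI[of _ "4*i-1"], rule exI[of _ "4*i"]) (use that in auto)
  have "card (B i \<inter> B (i + 1)) = 1" if "i \<ge> 1" for i
  proof -
    have "B i \<inter> B (i + 1) = {4*i}"
      using that by (auto simp: mem)
    then show ?thesis by simp
  qed
  moreover have "card {i\<in>{1..n}. v \<in> B i} \<le> 2" for v
  proof -
    have "{i\<in>{1..n}. v \<in> B i} \<subseteq> {(v + 3) div 4, (v + 4) div 4}"
      by (auto simp: mem)
    then have "card {i\<in>{1..n}. v \<in> B i} \<le> card {(v + 3) div 4, (v + 4) div 4}"
      by (intro card_mono) auto
    also have "\<dots> \<le> 2"
      by (simp add: card_insert_if)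
    finally show ?thesis .
  qed
  moreover have "{u, w} \<in> (\<Union>i\<in>{1..n}. F i)"
    if i: "i \<in> {2..<n}" and uw: "u \<in> B (i - 1) \<inter> B i" "w \<in> B i \<inter> B (i + 1)" for i u w
  proof -
    have "u = 4*i-4" "w = 4*i"
      using uw i by (auto simp: mem)
    then have "{u, w} \<in> F i"
      by (auto simp: F_def insert_commute)
    then show ?thesis using i by force
  qed
  moreover have "B i \<inter> B j = {}" if "i \<ge> 1" "i + 1 < j" for i j
    using that by (auto simp: mem)
  ultimately have "ortho_pentagonal_cactus n (\<Union>i\<in>{1..n}. B i) (\<Union>i\<in>{1..n}. F i)"
    unfolding ortho_pentagonal_cactus_def
    by (intro exI[of _ B] exI[of _ F]) (use cyc in auto)
  then show ?thesis by blast
qed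

end

theory Submission
  imports Defs
begin

text \<open>Grow the cactus one pentagon at a time and remember the vertex \<open>v\<close> at which the next pentagon
  will be glued. An independent set that dominates every vertex except possibly \<open>v\<close> contains \<open>v\<close>,
  or dominates \<open>v\<close> without containing it, or leaves \<open>v\<close> undominated. If \<open>a\<close>, \<open>b\<close>, \<open>c\<close> count these
  three kinds, gluing a pentagon whose next cut vertex is a neighbour of \<open>v\<close> replaces
  \<open>(a, b, c)\<close> by \<open>(2b + 2c, 2a + b + c, b)\<close>. The maximal independent sets are those of the first
  two kinds, and the recurrence is the characteristic equation
  \<open>t\<^sup>3 = t\<^sup>2 + 5t + 4\<close> of this linear map. The map applies also to the first pentagon, glued to a
  single vertex, for which \<open>(a, b, c) = (1, 0, 1)\<close>.\<close>

definition dominated :: "'a set set \<Rightarrow> 'a set \<Rightarrow> 'a \<Rightarrow> bool" where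
  "dominated E S u \<longleftrightarrow> (\<exists>t\<in>S. {u, t} \<in> E)"

definition almost_maximal :: "'a set \<Rightarrow> 'a set set \<Rightarrow> 'a \<Rightarrow> 'a set \<Rightarrow> bool" where
  "almost_maximal V E v S \<longleftrightarrow>
     S \<subseteq> V \<and> indep S E \<and> (\<forall>u\<in>V - S - {v}. dominated E S u)"

definition root_in :: "'a set \<Rightarrow> 'a set set \<Rightarrow> 'a \<Rightarrow> 'a set set" where
  "root_in V E v = {S. almost_maximal V E v S \<and> v \<in> S}"

definition root_dominated :: "'a set \<Rightarrow> 'a set set \<Rightarrow> 'a \<Rightarrow> 'a set set" where
  "root_dominated V E v = {S. almost_maximal V E v S \<and> v \<notin> S \<and> dominated E S v}"

definition root_free :: "'a set \<Rightarrow> 'a set set \<Rightarrow> 'a \<Rightarrow> 'a set set" where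
  "root_free V E v = {S. almost_maximal V E v S \<and> v \<notin> S \<and> \<not> dominated E S v}"

definition pentagon :: "'a \<Rightarrow> 'a \<Rightarrow> 'a \<Rightarrow> 'a \<Rightarrow> 'a \<Rightarrow> 'a set set" where
  "pentagon v x y z w = {{v, x}, {x, y}, {y, z}, {z, w}, {w, v}}"

inductive rooted_cactus :: "nat \<Rightarrow> 'a set \<Rightarrow> 'a set set \<Rightarrow> 'a \<Rightarrow> bool" where
  single: "rooted_cactus 0 {v} {} v"
| glue: "rooted_cactus n V E v \<Longrightarrow> distinct [x, y, z, w] \<Longrightarrow> V \<inter> {x, y, z, w} = {} \<Longrightarrow>
    rooted_cactus (Suc n) (V \<union> {x, y, z, w}) (E \<union> pentagon v x y z w) w"

lemma maximal_independent_set_iff: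
  assumes "v \<in> V"
  shows "maximal_independent_set V E S \<longleftrightarrow>
    almost_maximal V E v S \<and> (v \<in> S \<or> dominated E S v)"
proof -
  have "indep (insert u S) E \<longleftrightarrow> \<not> dominated E S u" if "indep S E" "u \<notin> S" for u
    using that unfolding indep_def dominated_def by (metis insert_commute insert_iff)
  then show ?thesis
    using assms unfolding maximal_independent_set_def almost_maximal_def by blast
qed

lemma card_maximal_independent_sets:
  assumes "v \<in> V" "finite V"
  shows "card {S. maximal_independent_set V E S} =
    card (root_in V E v) + card (root_dominated V E v)"
proof -
  have "{S. maximal_independent_set V E S} = root_in V E v \<union> root_dominated V E v"
    unfolding maximal_independent_set_iff[OF assms(1)] root_in_def root_dominated_def by auto
  moreover have "root_in V E v \<subseteq> Pow V" "root_dominated V E v \<subseteq> Pow V"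
    unfolding root_in_def root_dominated_def almost_maximal_def by auto
  moreover have "root_in V E v \<inter> root_dominated V E v = {}"
    unfolding root_in_def root_dominated_def by auto
  ultimately show ?thesis
    using assms(2) by (metis card_Un_disjoint finite_Pow_iff finite_subset)
qed

locale glued_pentagon =
  fixes V :: "'a set" and E :: "'a set set" and v x y z w :: 'a
  assumes finite_V: "finite V" and root: "v \<in> V" and edges: "\<Union>E \<subseteq> V"
    and new_distinct: "distinct [x, y, z, w]" and new: "V \<inter> {x, y, z, w} = {}"
begin

abbreviation N where "N \<equiv> {x, y, z, w}"
abbreviation V' where "V' \<equiv> V \<union> N"
abbreviation E' where "E' \<equiv> E \<union> pentagon v x y z w"

lemma vertices_distinct:
  "x \<noteq> y" "x \<noteq> z" "x \<noteq> w" "y \<noteq> z" "y \<noteq> w" "z \<noteq> w"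
  "v \<noteq> x" "v \<noteq> y" "v \<noteq> z" "v \<noteq> w" "x \<notin> V" "y \<notin> V" "z \<notin> V" "w \<notin> V"
  using new_distinct new root by auto

lemma edge_iff:
  "{s, t} \<in> E' \<longleftrightarrow> {s, t} \<in> E \<or> (s, t) \<in>
     {(v, x), (x, v), (x, y), (y, x), (y, z), (z, y), (z, w), (w, z), (w, v), (v, w)}"
  unfolding pentagon_def by (auto simp: doubleton_eq_iff)

lemma edge_in: "{s, t} \<in> E \<Longrightarrow> s \<in> V \<and> t \<in> V"
  using edges by auto

context
  fixes S T
  assumes S: "S \<subseteq> V" and T: "T \<subseteq> N"
begin

lemma parts_disjoint:
  "x \<notin> S" "y \<notin> S" "z \<notin> S" "w \<notin> S" "u \<in> V \<Longrightarrow> u \<notin> T"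
  using S T vertices_distinct by auto

lemma indep_glued:
  "indep (S \<union> T) E' \<longleftrightarrow> indep S E \<and> \<not> (v \<in> S \<and> (x \<in> T \<or> w \<in> T)) \<and>
     \<not> (x \<in> T \<and> y \<in> T) \<and> \<not> (y \<in> T \<and> z \<in> T) \<and> \<not> (z \<in> T \<and> w \<in> T)"
  (is "?L \<longleftrightarrow> ?R")
proof
  assume ?L
  then have "s \<in> S \<union> T \<Longrightarrow> t \<in> S \<union> T \<Longrightarrow> s \<noteq> t \<Longrightarrow> {s, t} \<notin> E'" for s t
    unfolding indep_def by blast
  then show ?R
    using vertices_distinct unfolding indep_def edge_iff by blast
next
  assume R: ?R
  have "{s, t} \<notin> E'" if "s \<in> S \<union> T" "t \<in> S \<union> T" "s \<noteq> t" for s t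
  proof
    assume "{s, t} \<in> E'"
    then consider "{s, t} \<in> E" | "(s, t) \<in>
      {(v, x), (x, v), (x, y), (y, x), (y, z), (z, y), (z, w), (w, z), (w, v), (v, w)}"
      unfolding edge_iff by blast
    then show False
    proof cases
      case 1
      then have "s \<in> S" "t \<in> S" using edge_in[of s t] parts_disjoint(5) that by auto
      then show False using 1 R that unfolding indep_def by blast
    next
      case 2
      then show False using R that parts_disjoint parts_disjoint(5)[OF root] by auto
    qed
  qed
  then show ?L unfolding indep_def by blast
qed

lemma dominated_glued:
  "u \<in> V \<Longrightarrow> u \<noteq> v \<Longrightarrow> dominated E' (S \<union> T) u \<longleftrightarrow> dominated E S u"
  "dominated E' (S \<union> T) v \<longleftrightarrow> dominated E S v \<or> x \<in> T \<or> w \<in> T"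
  "dominated E' (S \<union> T) x \<longleftrightarrow> v \<in> S \<or> y \<in> T"
  "dominated E' (S \<union> T) y \<longleftrightarrow> x \<in> T \<or> z \<in> T"
  "dominated E' (S \<union> T) z \<longleftrightarrow> y \<in> T \<or> w \<in> T"
  "dominated E' (S \<union> T) w \<longleftrightarrow> v \<in> S \<or> z \<in> T"
proof -
  have old: "t \<in> S" if "t \<in> S \<union> T" "{u, t} \<in> E" for u t
    using that edge_in[of u t] parts_disjoint(5) by auto
  show "u \<in> V \<Longrightarrow> u \<noteq> v \<Longrightarrow> dominated E' (S \<union> T) u \<longleftrightarrow> dominated E S u"
    unfolding dominated_def edge_iff using old vertices_distinct by blast
  show "dominated E' (S \<union> T) v \<longleftrightarrow> dominated E S v \<or> x \<in> T \<or> w \<in> T"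
    unfolding dominated_def edge_iff using old parts_disjoint vertices_distinct by blast
  show "dominated E' (S \<union> T) x \<longleftrightarrow> v \<in> S \<or> y \<in> T"
    unfolding dominated_def edge_iff
    using edge_in[of x] parts_disjoint parts_disjoint(5)[OF root] vertices_distinct by blast
  show "dominated E' (S \<union> T) y \<longleftrightarrow> x \<in> T \<or> z \<in> T"
    unfolding dominated_def edge_iff
    using edge_in[of y] parts_disjoint parts_disjoint(5)[OF root] vertices_distinct by blast
  show "dominated E' (S \<union> T) z \<longleftrightarrow> y \<in> T \<or> w \<in> T"
    unfolding dominated_def edge_iff
    using edge_in[of z] parts_disjoint parts_disjoint(5)[OF root] vertices_distinct by blast
  show "dominated E' (S \<union> T) w \<longleftrightarrow> v \<in> S \<or> z \<in> T"
    unfolding dominated_def edge_iff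
    using edge_in[of w] parts_disjoint parts_disjoint(5)[OF root] vertices_distinct by blast
qed

lemma almost_maximal_glued:
  "almost_maximal V' E' w (S \<union> T) \<longleftrightarrow> almost_maximal V E v S \<and>
     (v \<in> S \<or> dominated E S v \<or> x \<in> T \<or> w \<in> T) \<and>
     \<not> (v \<in> S \<and> (x \<in> T \<or> w \<in> T)) \<and>
     \<not> (x \<in> T \<and> y \<in> T) \<and> \<not> (y \<in> T \<and> z \<in> T) \<and> \<not> (z \<in> T \<and> w \<in> T) \<and>
     (x \<in> T \<or> v \<in> S \<or> y \<in> T) \<and> (y \<in> T \<or> x \<in> T \<or> z \<in> T) \<and> (z \<in> T \<or> y \<in> T \<or> w \<in> T)"
proof -
  have "(\<forall>u\<in>V' - (S \<union> T) - {w}. dominated E' (S \<union> T) u) \<longleftrightarrow>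
    (\<forall>u\<in>V - S - {v}. dominated E S u) \<and>
    (v \<in> S \<or> dominated E' (S \<union> T) v) \<and> (x \<in> T \<or> dominated E' (S \<union> T) x) \<and>
    (y \<in> T \<or> dominated E' (S \<union> T) y) \<and> (z \<in> T \<or> dominated E' (S \<union> T) z)" (is "?L \<longleftrightarrow> ?R")
  proof
    assume L: ?L
    have "dominated E S u" if "u \<in> V - S - {v}" for u
      using L that dominated_glued(1)[of u] parts_disjoint(5) vertices_distinct by blast
    then show ?R
      using L root parts_disjoint parts_disjoint(5)[OF root] vertices_distinct by blast
  next
    assume ?R
    then show ?L using dominated_glued(1) by blast
  qed
  moreover have "S \<union> T \<subseteq> V'" using S T by blast
  ultimately show ?thesis
    unfolding almost_maximal_def indep_glued dominated_glued(2-) using S by blast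
qed

lemma new_part_eq_iff:
  "T = {y} \<longleftrightarrow> x \<notin> T \<and> y \<in> T \<and> z \<notin> T \<and> w \<notin> T"
  "T = {z} \<longleftrightarrow> x \<notin> T \<and> y \<notin> T \<and> z \<in> T \<and> w \<notin> T"
  "T = {x, z} \<longleftrightarrow> x \<in> T \<and> y \<notin> T \<and> z \<in> T \<and> w \<notin> T"
  "T = {x, w} \<longleftrightarrow> x \<in> T \<and> y \<notin> T \<and> z \<notin> T \<and> w \<in> T"
  "T = {y, w} \<longleftrightarrow> x \<notin> T \<and> y \<in> T \<and> z \<notin> T \<and> w \<in> T"
  using T vertices_distinct by auto

lemma root_in_glued:
  "S \<union> T \<in> root_in V' E' w \<longleftrightarrow>
     S \<in> root_dominated V E v \<union> root_free V E v \<and> T \<in> {{x, w}, {y, w}}"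
  unfolding root_in_def root_dominated_def root_free_def mem_Collect_eq Un_iff insert_iff empty_iff
    almost_maximal_glued new_part_eq_iff
  using parts_disjoint by blast

lemma root_dominated_glued:
  "S \<union> T \<in> root_dominated V' E' w \<longleftrightarrow>
     S \<in> root_in V E v \<and> T \<in> {{y}, {z}} \<or>
     S \<in> root_dominated V E v \<union> root_free V E v \<and> T = {x, z}"
  unfolding root_in_def root_dominated_def root_free_def mem_Collect_eq Un_iff insert_iff empty_iff
    almost_maximal_glued new_part_eq_iff dominated_glued(6)
  using parts_disjoint by blast

lemma root_free_glued:
  "S \<union> T \<in> root_free V' E' w \<longleftrightarrow> S \<in> root_dominated V E v \<and> T = {y}"
  unfolding root_dominated_def root_free_def mem_Collect_eq Un_iff
    almost_maximal_glued new_part_eq_iff dominated_glued(6)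
  using parts_disjoint by blast

end

lemma card_glued:
  assumes "X \<subseteq> Pow V'" "P \<subseteq> Pow V \<times> Pow N"
    and "\<And>S T. S \<subseteq> V \<Longrightarrow> T \<subseteq> N \<Longrightarrow> S \<union> T \<in> X \<longleftrightarrow> (S, T) \<in> P"
  shows "card X = card P"
proof -
  have "bij_betw (\<lambda>(S, T). S \<union> T) P X"
    unfolding bij_betw_def
  proof
    show "inj_on (\<lambda>(S, T). S \<union> T) P"
    proof (rule inj_on_inverseI[where g = "\<lambda>A. (A \<inter> V, A \<inter> N)"])
      fix q
      assume "q \<in> P"
      then obtain S T where "q = (S, T)" "S \<subseteq> V" "T \<subseteq> N"
        using assms(2) by blast
      moreover from this have "(S \<union> T) \<inter> V = S" "(S \<union> T) \<inter> N = T"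
        using new by blast+
      ultimately show "((case q of (S, T) \<Rightarrow> S \<union> T) \<inter> V, (case q of (S, T) \<Rightarrow> S \<union> T) \<inter> N) = q"
        by (simp only: prod.case)
    qed
    have "A \<in> (\<lambda>(S, T). S \<union> T) ` P" if "A \<in> X" for A
    proof -
      have "A = (A \<inter> V) \<union> (A \<inter> N)" using that assms(1) by blast
      moreover from this have "(A \<inter> V, A \<inter> N) \<in> P"
        using assms(3)[of "A \<inter> V" "A \<inter> N"] that by simp
      ultimately show ?thesis by (metis (no_types, lifting) case_prod_conv image_eqI)
    qed
    moreover have "S \<union> T \<in> X" if "(S, T) \<in> P" for S T
      using that assms(2) assms(3)[of S T] by blast
    ultimately show "(\<lambda>(S, T). S \<union> T) ` P = X"
      by (intro subset_antisym) (auto simp only: image_iff prod.case)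
  qed
  then show ?thesis by (simp add: bij_betw_same_card)
qed

lemma root_sets_subset:
  "root_in V E v \<subseteq> Pow V" "root_dominated V E v \<subseteq> Pow V" "root_free V E v \<subseteq> Pow V"
  "root_in V' E' w \<subseteq> Pow V'" "root_dominated V' E' w \<subseteq> Pow V'" "root_free V' E' w \<subseteq> Pow V'"
  unfolding root_in_def root_dominated_def root_free_def almost_maximal_def by auto

lemma finite_root_sets:
  "finite (root_in V E v)" "finite (root_dominated V E v)" "finite (root_free V E v)"
  using root_sets_subset(1-3) finite_V by (meson finite_Pow_iff finite_subset)+

lemma card_root_dominated_Un_free:
  "card (root_dominated V E v \<union> root_free V E v) =
    card (root_dominated V E v) + card (root_free V E v)"
  by (rule card_Un_disjoint)
    (use finite_root_sets in \<open>auto simp: root_dominated_def root_free_def\<close>)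

lemma card_root_in_glued:
  "card (root_in V' E' w) = 2 * card (root_dominated V E v) + 2 * card (root_free V E v)"
proof -
  have "card (root_in V' E' w) =
      card ((root_dominated V E v \<union> root_free V E v) \<times> {{x, w}, {y, w}})"
    by (rule card_glued[OF root_sets_subset(4)], use root_sets_subset(1-3) in blast)
      (simp only: root_in_glued mem_Sigma_iff Un_iff singleton_iff)
  moreover have "{x, w} \<noteq> {y, w}"
    using vertices_distinct by (auto simp: doubleton_eq_iff)
  ultimately show ?thesis
    by (simp add: card_cartesian_product card_root_dominated_Un_free)
qed

lemma card_root_dominated_glued:
  "card (root_dominated V' E' w) =
    2 * card (root_in V E v) + card (root_dominated V E v) + card (root_free V E v)"
proof -
  have "card (root_dominated V' E' w) = card (root_in V E v \<times> {{y}, {z}} \<union>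
      (root_dominated V E v \<union> root_free V E v) \<times> {{x, z}})"
    by (rule card_glued[OF root_sets_subset(5)], use root_sets_subset(1-3) in blast)
      (simp only: root_dominated_glued mem_Sigma_iff Un_iff singleton_iff)
  also have "\<dots> = card (root_in V E v \<times> {{y}, {z}}) +
      card ((root_dominated V E v \<union> root_free V E v) \<times> {{x, z}})"
    by (rule card_Un_disjoint)
      (use finite_root_sets in \<open>auto simp: root_in_def root_dominated_def root_free_def\<close>)
  finally show ?thesis
    using vertices_distinct by (simp add: card_cartesian_product card_root_dominated_Un_free)
qed

lemma card_root_free_glued:
  "card (root_free V' E' w) = card (root_dominated V E v)"
proof -
  have "card (root_free V' E' w) = card (root_dominated V E v \<times> {{y}})"
    by (rule card_glued[OF root_sets_subset(6)], use root_sets_subset(1-3) in blast)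
      (simp only: root_free_glued mem_Sigma_iff Un_iff singleton_iff)
  then show ?thesis by (simp add: card_cartesian_product)
qed

end

fun root_counts :: "nat \<Rightarrow> nat \<times> nat \<times> nat" where
  "root_counts 0 = (1, 0, 1)"
| "root_counts (Suc n) = (case root_counts n of (a, b, c) \<Rightarrow> (2 * b + 2 * c, 2 * a + b + c, b))"

lemma rooted_cactus_wf:
  "rooted_cactus n V E v \<Longrightarrow> finite V \<and> v \<in> V \<and> \<Union>E \<subseteq> V"
  by (induction rule: rooted_cactus.induct) (auto simp: pentagon_def)

lemma rooted_cactus_counts:
  "rooted_cactus n V E v \<Longrightarrow>
    (card (root_in V E v), card (root_dominated V E v), card (root_free V E v)) = root_counts n"
proof (induction rule: rooted_cactus.induct)
  case (single v)
  have "root_in {v} {} v = {{v}}" "root_dominated {v} {} v = {}" "root_free {v} {} v = {{}}"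
    unfolding root_in_def root_dominated_def root_free_def almost_maximal_def dominated_def indep_def
    by auto
  then show ?case by simp
next
  case (glue n V E v x y z w)
  interpret glued_pentagon V E v x y z w
    using rooted_cactus_wf[OF glue.hyps(1)] glue.hyps(2,3) by unfold_locales simp_all
  show ?case
    unfolding card_root_in_glued card_root_dominated_glued card_root_free_glued
      root_counts.simps glue.IH[symmetric] by simp
qed

lemma card_maximal_independent_sets_rooted_cactus:
  assumes "rooted_cactus n V E v"
  shows "card {S. maximal_independent_set V E S} = (case root_counts n of (a, b, c) \<Rightarrow> a + b)"
  unfolding rooted_cactus_counts[OF assms, symmetric]
  using card_maximal_independent_sets[of v V E] rooted_cactus_wf[OF assms] by simp

lemma five_cycle_neighbour:
  assumes "five_cycle C F" "v \<in> C"
  obtains w where "{v, w} \<in> F"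
  using assms unfolding five_cycle_def by (fastforce simp: doubleton_eq_iff)

lemma five_cycle_edge_subset: "five_cycle C F \<Longrightarrow> e \<in> F \<Longrightarrow> e \<subseteq> C"
  unfolding five_cycle_def by auto

lemma five_cycle_pentagon:
  assumes "five_cycle C F" "{v, w} \<in> F"
  obtains x y z where "distinct [v, x, y, z, w]" "C = {v, x, y, z, w}" "F = pentagon v x y z w"
proof -
  obtain a b c d e where d: "distinct [a, b, c, d, e]" and C: "C = {a, b, c, d, e}"
    and F: "F = {{a, b}, {b, c}, {c, d}, {d, e}, {e, a}}"
    using assms(1) unfolding five_cycle_def by blast
  have rotations: "C = {b, c, d, e, a}" "C = {c, d, e, a, b}" "C = {d, e, a, b, c}"
    "C = {e, a, b, c, d}"
    "F = {{b, c}, {c, d}, {d, e}, {e, a}, {a, b}}" "F = {{c, d}, {d, e}, {e, a}, {a, b}, {b, c}}"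
    "F = {{d, e}, {e, a}, {a, b}, {b, c}, {c, d}}" "F = {{e, a}, {a, b}, {b, c}, {c, d}, {d, e}}"
    unfolding C F by auto
  have "\<exists>x y z. distinct [v, x, y, z, w] \<and> C = {v, x, y, z, w} \<and> F = pentagon v x y z w"
    if d: "distinct [a, b, c, d, e]" and C: "C = {a, b, c, d, e}"
    and F: "F = {{a, b}, {b, c}, {c, d}, {d, e}, {e, a}}" and "{v, w} = {e, a}" for a b c d e
  proof -
    from that(4) consider "v = a" "w = e" | "v = e" "w = a" by (auto simp: doubleton_eq_iff)
    then show ?thesis
    proof cases
      case 1
      then show ?thesis using d C F unfolding pentagon_def by blast
    next
      case 2
      have "distinct [e, d, c, b, a] \<and> C = {e, d, c, b, a} \<and> F = pentagon e d c b a"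
        using d unfolding C F pentagon_def by (auto simp: insert_commute)
      then show ?thesis using 2 by blast
    qed
  qed
  note * = this
  have "{v, w} \<in> {{a, b}, {b, c}, {c, d}, {d, e}, {e, a}}"
    using assms(2) F by simp
  then have "\<exists>x y z. distinct [v, x, y, z, w] \<and> C = {v, x, y, z, w} \<and> F = pentagon v x y z w"
  proof (elim insertE emptyE)
    assume "{v, w} = {a, b}"
    show ?thesis by (rule *[OF _ rotations(1,5) \<open>{v, w} = _\<close>]) (use d in auto)
  next
    assume "{v, w} = {b, c}"
    show ?thesis by (rule *[OF _ rotations(2,6) \<open>{v, w} = _\<close>]) (use d in auto)
  next
    assume "{v, w} = {c, d}"
    show ?thesis by (rule *[OF _ rotations(3,7) \<open>{v, w} = _\<close>]) (use d in auto)
  next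
    assume "{v, w} = {d, e}"
    show ?thesis by (rule *[OF _ rotations(4,8) \<open>{v, w} = _\<close>]) (use d in auto)
  next
    assume "{v, w} = {e, a}"
    then show ?thesis by (rule *[OF d C F])
  qed
  then show ?thesis using that by blast
qed

lemma ortho_pentagonal_cactus_rooted:
  assumes "ortho_pentagonal_cactus n V E" "n \<ge> 1"
  obtains v where "rooted_cactus n V E v"
proof -
  obtain B F where cyc: "\<forall>i\<in>{1..n}. five_cycle (B i) (F i)"
    and V: "V = (\<Union>i\<in>{1..n}. B i)" and E: "E = (\<Union>i\<in>{1..n}. F i)"
    and cut: "\<forall>i\<in>{1..<n}. card (B i \<inter> B (i + 1)) = 1"
    and disj: "\<forall>i\<in>{1..n}. \<forall>j\<in>{1..n}. i + 1 < j \<longrightarrow> B i \<inter> B j = {}"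
    and adj: "\<forall>i\<in>{2..<n}. \<forall>u\<in>B (i - 1) \<inter> B i. \<forall>w\<in>B i \<inter> B (i + 1). {u, w} \<in> E"
    using assms(1) unfolding ortho_pentagonal_cactus_def by (elim exE conjE) (rule that)
  note cyc = cyc[rule_format] and cut = cut[rule_format] and disj = disj[rule_format]
    and adj = adj[rule_format]
  have adj_F: "{u, w} \<in> F (m + 1)"
    if m: "1 \<le> m" "m + 1 < n" and u: "u \<in> B m \<inter> B (m + 1)"
      and w: "w \<in> B (m + 1) \<inter> B (m + 2)" for m u w
  proof -
    obtain j where j: "j \<in> {1..n}" "{u, w} \<in> F j"
      using adj[of "m + 1" u w] m u w unfolding E by auto
    then have "u \<in> B j" "w \<in> B j"
      using five_cycle_edge_subset[OF cyc] by blast+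
    moreover have "\<not> m + 1 < j" "\<not> j < m + 1"
      using disj[of m j] disj[of j "m + 2"] m u w j(1) \<open>u \<in> B j\<close> \<open>w \<in> B j\<close> by auto
    ultimately show ?thesis using j(2) by (metis linorder_neqE_nat)
  qed
  define ready where "ready m v \<longleftrightarrow> v \<in> B (m + 1) \<and> (1 \<le> m \<longrightarrow> v \<in> B m) \<and>
    (m + 1 < n \<longrightarrow> (\<forall>w\<in>B (m + 1) \<inter> B (m + 2). {v, w} \<in> F (m + 1)))" for m v
  have "\<exists>v. rooted_cactus m (insert v (\<Union>i\<in>{1..m}. B i)) (\<Union>i\<in>{1..m}. F i) v \<and>
      (1 \<le> m \<longrightarrow> v \<in> B m) \<and> (m < n \<longrightarrow> ready m v)" if "m \<le> n" for m
    using that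
  proof (induction m)
    case 0
    have c1: "five_cycle (B 1) (F 1)" using cyc assms(2) by simp
    have "\<exists>v. ready 0 v"
    proof (cases "1 < n")
      case True
      then obtain w where w: "B 1 \<inter> B 2 = {w}"
        using cut[of 1] by (auto simp: card_1_singleton_iff numeral_2_eq_2)
      then obtain v where "{w, v} \<in> F 1"
        using five_cycle_neighbour[OF c1] by blast
      then have "{v, w} \<in> F 1" "v \<in> B 1"
        using five_cycle_edge_subset[OF c1, of "{w, v}"] by (auto simp: insert_commute)
      then show ?thesis
        using w by (intro exI[of _ v]) (simp add: ready_def numeral_2_eq_2)
    next
      case False
      then show ?thesis using c1 unfolding ready_def five_cycle_def by auto
    qed
    then show ?case using rooted_cactus.single by fastforce
  next
    case (Suc m)
    then obtain v where v: "rooted_cactus m (insert v (\<Union>i\<in>{1..m}. B i)) (\<Union>i\<in>{1..m}. F i) v"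
      and r: "ready m v" by auto
    have c: "five_cycle (B (m + 1)) (F (m + 1))" using cyc Suc.prems by simp
    have "\<exists>w. {v, w} \<in> F (m + 1) \<and> (m + 1 < n \<longrightarrow> w \<in> B (m + 2))"
    proof (cases "m + 1 < n")
      case True
      then obtain w where "B (m + 1) \<inter> B (m + 2) = {w}"
        using cut[of "m + 1"] by (auto simp: card_1_singleton_iff)
      then show ?thesis using r True unfolding ready_def by blast
    next
      case False
      then show ?thesis using five_cycle_neighbour[OF c] r unfolding ready_def by metis
    qed
    then obtain w where w: "{v, w} \<in> F (m + 1)" "m + 1 < n \<Longrightarrow> w \<in> B (m + 2)" by blast
    obtain x y z where p: "distinct [v, x, y, z, w]" "B (m + 1) = {v, x, y, z, w}"
      "F (m + 1) = pentagon v x y z w"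
      using five_cycle_pentagon[OF c w(1)] .
    have old: "B i \<inter> B (m + 1) \<subseteq> {v}" if "i \<in> {1..m}" for i
    proof (cases "i = m")
      case True
      then have "card (B m \<inter> B (m + 1)) = 1" "v \<in> B m \<inter> B (m + 1)"
        using that cut[of m] Suc.prems r unfolding ready_def by auto
      then have "B m \<inter> B (m + 1) = {v}"
        by (metis card_1_singletonE singletonD)
      then show ?thesis using True by simp
    next
      case False
      then show ?thesis using disj[of i "m + 1"] that Suc.prems by auto
    qed
    have "insert v (\<Union>i\<in>{1..m}. B i) \<inter> {x, y, z, w} = {}"
      using old p(1,2) by fastforce
    then have "rooted_cactus (Suc m) (insert v (\<Union>i\<in>{1..m}. B i) \<union> {x, y, z, w})
        ((\<Union>i\<in>{1..m}. F i) \<union> pentagon v x y z w) w"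
      using p(1) v by (intro rooted_cactus.glue) auto
    moreover have "insert v (\<Union>i\<in>{1..m}. B i) \<union> {x, y, z, w} = insert w (\<Union>i\<in>{1..Suc m}. B i)"
      using p(2) by (auto simp: atLeastAtMostSuc_conv)
    moreover have "(\<Union>i\<in>{1..m}. F i) \<union> pentagon v x y z w = (\<Union>i\<in>{1..Suc m}. F i)"
      using p(3) by (auto simp: atLeastAtMostSuc_conv)
    moreover have "w \<in> B (Suc m)" using p(2) by simp
    moreover have "ready (Suc m) w" if "Suc m < n"
      using adj_F[of "Suc m" w] w(2) that \<open>w \<in> B (Suc m)\<close> unfolding ready_def by simp
    ultimately show ?case by auto
  qed
  from this[of n] obtain v where "rooted_cactus n (insert v V) E v" "v \<in> B n"
    using assms(2) unfolding V E by auto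
  moreover from this(2) have "insert v V = V" using assms(2) unfolding V by auto
  ultimately show ?thesis using that by simp
qed

theorem theorem2p10:
  fixes V :: "nat \<Rightarrow> 'a set" and E :: "nat \<Rightarrow> 'a set set" and p :: "nat \<Rightarrow> nat"
  assumes "\<And>n. n \<ge> 1 \<Longrightarrow> ortho_pentagonal_cactus n (V n) (E n)"
    and "\<And>n. n \<ge> 1 \<Longrightarrow> p n = card {S. maximal_independent_set (V n) (E n) S}"
  shows "p 1 = 5 \<and> p 2 = 13 \<and> p 3 = 42 \<and> p 4 = 127 \<and>
    (\<forall>n\<ge>5. p n = p (n - 1) + 5 * p (n - 2) + 4 * p (n - 3))"
proof -
  have p: "p n = (case root_counts n of (a, b, c) \<Rightarrow> a + b)" if "n \<ge> 1" for n
    using ortho_pentagonal_cactus_rooted[OF assms(1)[OF that] that] assms(2)[OF that]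
      card_maximal_independent_sets_rooted_cactus by metis
  have "p n = p (n - 1) + 5 * p (n - 2) + 4 * p (n - 3)" if "n \<ge> 5" for n
  proof -
    define m where "m = n - 3"
    then have "n = Suc (Suc (Suc m))" "m \<ge> 1"
      using \<open>n \<ge> 5\<close> by auto
    then show ?thesis by (simp add: p split: prod.splits)
  qed
  then show ?thesis by (simp add: p numeral_eq_Suc)
qed

end
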